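(* Let $(X,\mathcal W)$ be a balayage space satisfying the axiom of polarity. Let $\varphi\colon X\to[0,\infty]$ be a function and let $P\subset X$ be a polar set such that $\hat R_\varphi=R_\varphi$ on $X\setminus P$. Then $$R_\varphi=(\varphi 1_P)\vee \hat R_{\varphi 1_{X\setminus P}}=\varphi\vee\hat R_\varphi \quad\text{and}\quad \hat R_{\varphi 1_{X\setminus P}}=R_{\varphi 1_{X\setminus P}}=\hat R_\varphi .$$ In particular, $R_\varphi\in\tilde{\mathcal B}(X)$. Moreover, $R_\varphi\in\mathcal B(X)$ if $\varphi\in\mathcal B(X)$.
   Context: Balayage space: $X$ is a locally compact Hausdorff space with countable base and $\mathcal W$ is a convex cone of lower semicontinuous functions $u\colon X\to[0,\infty]$ (the positive hyperharmonic functions on $X$) such that: (B1) $\sup_n v_n\in\mathcal W$ for every increasing sequence $(v_n)$ in $\mathcal W$; (B2) for every $\mathcal V\subset\mathcal W$, the lower semicontinuous regularization of $\inf\mathcal V$ with respect to the fine topology (the coarsest topology on $X$ that is at least as fine as the initial one and for which all functions in $\mathcal W$ are continuous) belongs to $\mathcal W$; (B3) if $u,v',v''\in\mathcal W$ and $u\le v'+v''$, there are $u',u''\in\mathcal W$ with $u=u'+u''$, $u'\le v'$, $u''\le v''$; (B4) for all $x\ne y$ in $X$ and $\gamma>0$ there is $u\in\mathcal W$ with $u(x)\ne\gamma u(y)$; every $w\in\mathcal W$ is the supremum of all continuous real $v\in\mathcal W$ with $v\le w$; and there are strictly positive continuous real functions $u,v\in\mathcal W$ such that $u/v$ tends to $0$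 at infinity. "Numerical" means with values in $[-\infty,\infty]$. $\mathcal B(X)$ is the set of all numerical Borel measurable functions on $X$. Operations $\vee$ (maximum) are pointwise, and $0\cdot\infty=0$. For $\varphi\colon X\to[0,\infty]$, $R_\varphi:=\inf\{u\in\mathcal W: u\ge\varphi\}$ (pointwise infimum). For a numerical function $v$ on $X$, $\hat v(x):=\liminf_{y\to x}v(y)$ is its lower semicontinuous regularization (in the initial topology), and $\hat R_\varphi:=\widehat{R_\varphi}$. A set $P\subset X$ is polar if it has no interior points and, for every $x\in X$, there is $u\in\mathcal W$ with $u=\infty$ on $P\setminus\{x\}$ and $u(x)<\infty$. Axiom of polarity (Hunt's hypothesis (H)): every set $\{\hat v<v\}$, where $v=\inf\mathcal V$ for some $\mathcal V\subset\mathcal W$ (such sets are called semipolar here), is polar. $\tilde{\mathcal B}(X)$ is the set of all numerical functions $\varphi$ on $X$ for which there exist $\varphi_1,\varphi_2\in\mathcal B(X)$ with $\varphi_1\le\varphi\le\varphi_2$ on $X$ and $\varphi_1=\varphi_2$ outside a polar set. *)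

theory Defs
  imports "HOL-Analysis.Analysis"
begin

text \<open>
  The space \<open>X\<close> is a type \<open>'a\<close>. Functions with values in $[0,\infty]$ have codomain
  \<^typ>\<open>ennreal\<close> (where \<open>0 * \<infinity> = 0\<close>), numerical functions have codomain \<^typ>\<open>ereal\<close>.
  Order, \<open>Inf\<close> and \<open>Sup\<close> of functions are pointwise; in particular the infimum of the
  empty family is \<open>\<infinity>\<close>.
\<close>

definition lower_semicont :: "('a::topological_space \<Rightarrow> ennreal) \<Rightarrow> bool" where
  "lower_semicont u \<longleftrightarrow> (\<forall>a. open {x. a < u x})"

text \<open>
  In the regularization \<open>liminf\<close> is taken over full neighbourhoods, the point \<open>x\<close> itself
  included, so that the result is the greatest lower semicontinuous minorant.
\<close>

definition lsc_reg_in :: "'a topology \<Rightarrow> ('a \<Rightarrow> ennreal) \<Rightarrow> 'a \<Rightarrow> ennreal" where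
  "lsc_reg_in T v = (\<lambda>x. Liminf (nhdsin T x) v)"

definition lsc_reg :: "('a::topological_space \<Rightarrow> ennreal) \<Rightarrow> 'a \<Rightarrow> ennreal" where
  "lsc_reg v = (\<lambda>x. Liminf (nhds x) v)"

definition fine_topology :: "('a::topological_space \<Rightarrow> ennreal) set \<Rightarrow> 'a topology" where
  "fine_topology W =
     topology_generated_by ({U. open U} \<union> {u -` V | u V. u \<in> W \<and> open V})"

text \<open>
  Filter of neighbourhoods of the point at infinity, generated by the complements of compact
  sets; it is \<^const>\<open>bot\<close> if the space is compact.
\<close>

definition near_infinity :: "'a::topological_space filter" where
  "near_infinity = (INF K\<in>{K. compact K}. principal (- K))"

definition cont_real :: "('a::topological_space \<Rightarrow> ennreal) \<Rightarrow> bool" where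
  "cont_real v \<longleftrightarrow> continuous_on UNIV v \<and> (\<forall>x. v x < \<infinity>)"

locale balayage_space =
  fixes W :: "('a::{t2_space, second_countable_topology} \<Rightarrow> ennreal) set"
  assumes locally_compact: "locally_compact_space (euclidean :: 'a topology)"
    and lsc: "u \<in> W \<Longrightarrow> lower_semicont u"
    and cone_add: "u \<in> W \<Longrightarrow> v \<in> W \<Longrightarrow> (\<lambda>x. u x + v x) \<in> W"
    and cone_scale: "u \<in> W \<Longrightarrow> 0 \<le> c \<Longrightarrow> (\<lambda>x. ennreal c * u x) \<in> W"
    and B1: "(\<And>n. f n \<in> W) \<Longrightarrow> incseq f \<Longrightarrow> (SUP n::nat. f n) \<in> W"
    and B2: "V \<subseteq> W \<Longrightarrow> lsc_reg_in (fine_topology W) (Inf V) \<in> W"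
    and B3: "u \<in> W \<Longrightarrow> v' \<in> W \<Longrightarrow> v'' \<in> W \<Longrightarrow> (\<forall>x. u x \<le> v' x + v'' x) \<Longrightarrow>
      \<exists>u'\<in>W. \<exists>u''\<in>W. (\<forall>x. u x = u' x + u'' x) \<and> u' \<le> v' \<and> u'' \<le> v''"
    and B4_separation: "x \<noteq> y \<Longrightarrow> 0 < \<gamma> \<Longrightarrow> \<exists>u\<in>W. u x \<noteq> ennreal \<gamma> * u y"
    and B4_approximation: "w \<in> W \<Longrightarrow> w = Sup {v \<in> W. cont_real v \<and> v \<le> w}"
    and B4_infinity: "\<exists>u\<in>W. \<exists>v\<in>W. cont_real u \<and> cont_real v \<and> (\<forall>x. 0 < u x \<and> 0 < v x) \<and>
      ((\<lambda>x. u x / v x) \<longlongrightarrow> 0) near_infinity"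

definition reduced :: "('a \<Rightarrow> ennreal) set \<Rightarrow> ('a \<Rightarrow> ennreal) \<Rightarrow> 'a \<Rightarrow> ennreal" where
  "reduced W \<phi> = Inf {u \<in> W. \<phi> \<le> u}"

definition reg_reduced ::
  "('a::topological_space \<Rightarrow> ennreal) set \<Rightarrow> ('a \<Rightarrow> ennreal) \<Rightarrow> 'a \<Rightarrow> ennreal" where
  "reg_reduced W \<phi> = lsc_reg (reduced W \<phi>)"

definition polar :: "('a::topological_space \<Rightarrow> ennreal) set \<Rightarrow> 'a set \<Rightarrow> bool" where
  "polar W P \<longleftrightarrow> interior P = {} \<and> (\<forall>x. \<exists>u\<in>W. (\<forall>y\<in>P - {x}. u y = \<infinity>) \<and> u x < \<infinity>)"

definition semipolar :: "('a::topological_space \<Rightarrow> ennreal) set \<Rightarrow> 'a set \<Rightarrow> bool" where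
  "semipolar W S \<longleftrightarrow> (\<exists>V\<subseteq>W. S = {x. lsc_reg (Inf V) x < Inf V x})"

definition axiom_of_polarity :: "('a::topological_space \<Rightarrow> ennreal) set \<Rightarrow> bool" where
  "axiom_of_polarity W \<longleftrightarrow> (\<forall>S. semipolar W S \<longrightarrow> polar W S)"

definition Borel_functions :: "('a::topological_space \<Rightarrow> ereal) set" where
  "Borel_functions = borel_measurable borel"

definition nearly_Borel_functions ::
  "('a::topological_space \<Rightarrow> ennreal) set \<Rightarrow> ('a \<Rightarrow> ereal) set" where
  "nearly_Borel_functions W =
     {\<phi>. \<exists>\<phi>\<^sub>1\<in>Borel_functions. \<exists>\<phi>\<^sub>2\<in>Borel_functions. \<phi>\<^sub>1 \<le> \<phi> \<and> \<phi> \<le> \<phi>\<^sub>2 \<and>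
        (\<exists>P. polar W P \<and> (\<forall>x. x \<notin> P \<longrightarrow> \<phi>\<^sub>1 x = \<phi>\<^sub>2 x))}"

end

theory Submission
  imports Defs
begin

text \<open>
  By (B2), \<open>w\<close>, the regularization of the reduced function of \<open>\<phi>\<close>, belongs to \<open>W\<close>. Adding
  small multiples of a function of \<open>W\<close> that is infinite on \<open>P\<close> shows that \<open>w \<le> v\<close> off \<open>P\<close>
  whenever \<open>v \<in> W\<close> majorizes \<open>\<phi>\<close> off \<open>P\<close>. The set where \<open>v < w\<close> is finely open, so it is empty
  once polar sets are known to have no fine interior. For the latter, a finely open subset of a polar
  set consists of finely isolated points \<open>x\<close>; but the infimum of all functions of \<open>W\<close> that are
  infinite at \<open>x\<close> is \<open>\<infinity>\<close> at \<open>x\<close> and \<open>0\<close> elsewhere, and if \<open>x\<close> is finely isolated, then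
  (B2) makes this function lower semicontinuous, so that \<open>x\<close> is an interior point. At a point of
  \<open>P\<close> where \<open>w < \<phi>\<close>, the gap is filled by a multiple of a strictly positive real function in
  \<open>W\<close>. Near Borel measurability comes from Choquet's lemma: a countable subfamily has an infimum with
  the same regularization.
\<close>

lemma ennreal_scale_le:
  fixes e :: real
  assumes "z < \<infinity>" "0 < e"
  obtains c :: real where "0 < c" "ennreal c * z \<le> ennreal e"
proof -
  define r where "r = enn2real z"
  have r: "0 \<le> r" "z = ennreal r"
    using assms(1) by (simp_all add: r_def)
  \<comment> \<open>The summand 1 keeps the quotient defined when \<open>z\<close> is 0.\<close>
  have "0 < e / (r + 1)" "e / (r + 1) * r \<le> e"
    using r(1) assms(2) by (simp_all add: field_simps add_nonneg_pos)
  then show ?thesis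
    using that[of "e / (r + 1)"] r by (simp add: ennreal_leI flip: ennreal_mult)
qed

section \<open>Fine neighbourhoods and lower semicontinuous regularization\<close>

lemma topspace_fine_topology [simp]: "topspace (fine_topology W) = UNIV"
  unfolding fine_topology_def topology_generated_by_topspace by auto

lemma openin_fine_topology_vimage:
  "u \<in> W \<Longrightarrow> open V \<Longrightarrow> openin (fine_topology W) (u -` V)"
  unfolding fine_topology_def by (rule topology_generated_by_Basis) blast

lemma openin_fine_topology_open: "open U \<Longrightarrow> openin (fine_topology W) U"
  unfolding fine_topology_def by (rule topology_generated_by_Basis) blast

lemma le_lsc_reg_in_iff:
  assumes "x \<in> topspace T"
  shows "c \<le> lsc_reg_in T v x \<longleftrightarrow> (\<forall>a<c. \<exists>S. openin T S \<and> x \<in> S \<and> (\<forall>y\<in>S. a < v y))"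
  using assms by (simp add: lsc_reg_in_def le_Liminf_iff eventually_nhdsin)

lemma le_lsc_reg_iff:
  "c \<le> lsc_reg v x \<longleftrightarrow> (\<forall>a<c. \<exists>S. open S \<and> x \<in> S \<and> (\<forall>y\<in>S. a < v y))"
  by (simp add: lsc_reg_def le_Liminf_iff eventually_nhds)

lemma lsc_reg_in_le:
  assumes "x \<in> topspace T"
  shows "lsc_reg_in T v x \<le> v x"
proof (rule ccontr)
  assume "\<not> lsc_reg_in T v x \<le> v x"
  then have "\<exists>S. openin T S \<and> x \<in> S \<and> (\<forall>y\<in>S. v x < v y)"
    using le_lsc_reg_in_iff[OF assms, of "lsc_reg_in T v x" v] by (simp add: not_le)
  then show False
    by blast
qed

lemma lsc_reg_le: "lsc_reg v \<le> v"
proof (rule le_funI, rule ccontr)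
  fix x assume "\<not> lsc_reg v x \<le> v x"
  then have "\<exists>S. open S \<and> x \<in> S \<and> (\<forall>y\<in>S. v x < v y)"
    using le_lsc_reg_iff[of "lsc_reg v x" v x] by (simp add: not_le)
  then show False
    by blast
qed

lemma lower_semicont_le_lsc_reg:
  assumes "lower_semicont g" "g \<le> v"
  shows "g \<le> lsc_reg v"
proof (rule le_funI)
  fix x show "g x \<le> lsc_reg v x"
    unfolding le_lsc_reg_iff
  proof (intro allI impI)
    fix a assume "a < g x"
    with assms show "\<exists>S. open S \<and> x \<in> S \<and> (\<forall>y\<in>S. a < v y)"
      by (intro exI[of _ "{y. a < g y}"])
        (auto simp: lower_semicont_def le_fun_def intro: less_le_trans)
  qed
qed

lemma lsc_reg_eq: "lower_semicont g \<Longrightarrow> lsc_reg g = g"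
  by (intro antisym lsc_reg_le lower_semicont_le_lsc_reg order_refl)

lemma lower_semicont_borel_measurable:
  "lower_semicont g \<Longrightarrow> g \<in> borel_measurable borel"
  by (rule borel_measurableI_greater) (simp add: lower_semicont_def)

text \<open>The regularization of an infimum depends only on its infima over the sets of a base.
  Each of these is an infimum of numbers, hence already reached by countably many members of
  \<open>V\<close>; a countable base then keeps the union of the choices countable.\<close>

lemma choquet_lsc_reg:
  fixes V :: "('a::second_countable_topology \<Rightarrow> ennreal) set"
  obtains D where "countable D" "D \<subseteq> V" "lsc_reg (Inf D) = lsc_reg (Inf V)"
proof -
  obtain \<B> :: "'a set set" where \<B>: "countable \<B>" "topological_basis \<B>"
    using ex_countable_basis by blast
  have "\<exists>C. countable C \<and> C \<subseteq> V \<and> (INF u\<in>C. INF y\<in>B. u y) = (INF u\<in>V. INF y\<in>B. u y)" for B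
  proof (cases "V = {}")
    case False
    then obtain f :: "nat \<Rightarrow> ennreal" where
      f: "range f \<subseteq> (\<lambda>u. INF y\<in>B. u y) ` V" "(INF u\<in>V. INF y\<in>B. u y) = (INF i. f i)"
      using ennreal_Inf_countable_INF[of "(\<lambda>u. INF y\<in>B. u y) ` V"] by auto
    have "\<forall>i. \<exists>u\<in>V. f i = (INF y\<in>B. u y)"
      using f(1) by blast
    then obtain g where g: "\<And>i. g i \<in> V" "\<And>i. f i = (INF y\<in>B. g i y)"
      by metis
    show ?thesis
      using g f(2) by (intro exI[of _ "range g"]) (auto simp: image_image)
  qed auto
  then obtain C where C: "\<And>B. countable (C B)" "\<And>B. C B \<subseteq> V"
    "\<And>B. (INF u\<in>C B. INF y\<in>B. u y) = (INF u\<in>V. INF y\<in>B. u y)"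
    by metis
  define D where "D = (\<Union>B\<in>\<B>. C B)"
  have DV: "D \<subseteq> V"
    using C(2) by (auto simp: D_def)
  have "lsc_reg (Inf D) \<le> lsc_reg (Inf V)"
  proof (intro le_funI, unfold le_lsc_reg_iff, intro allI impI)
    fix x a assume "a < lsc_reg (Inf D) x"
    \<comment> \<open>The passage through infima preserves only the weak bound \<open>b\<close>, so
      the strict bound \<open>a\<close> needs room below it.\<close>
    then obtain b where b: "a < b" "b < lsc_reg (Inf D) x"
      using dense by blast
    then obtain S where S: "open S" "x \<in> S" "\<forall>y\<in>S. b < Inf D y"
      using le_lsc_reg_iff[of "lsc_reg (Inf D) x" "Inf D" x] by blast
    obtain B where B: "B \<in> \<B>" "x \<in> B" "B \<subseteq> S"
      using topological_basisE[OF \<B>(2) S(1,2)] by metis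
    have "b \<le> (INF u\<in>C B. INF y\<in>B. u y)"
    proof (intro INF_greatest)
      fix u y assume "u \<in> C B" "y \<in> B"
      then have "b < Inf D y" "Inf D y \<le> u y"
        using S(3) B by (auto simp: D_def Inf_fun_def intro!: INF_lower)
      then show "b \<le> u y"
        by simp
    qed
    then have "b \<le> (INF u\<in>V. INF y\<in>B. u y)"
      by (simp add: C(3))
    then have "\<forall>y\<in>B. b \<le> Inf V y"
      by (auto simp: Inf_fun_def le_INF_iff)
    then show "\<exists>S. open S \<and> x \<in> S \<and> (\<forall>y\<in>S. a < Inf V y)"
      using b(1) B topological_basis_open[OF \<B>(2)] by (intro exI[of _ B]) (auto intro: less_le_trans)
  qed
  moreover have "lsc_reg (Inf V) \<le> lsc_reg (Inf D)"
    unfolding lsc_reg_def using Inf_superset_mono[OF DV]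
    by (intro le_funI Liminf_mono always_eventually allI) (auto simp: le_fun_def)
  moreover have "countable D"
    unfolding D_def using \<B>(1) C(1) by auto
  ultimately show ?thesis
    using that DV by (metis antisym)
qed

section \<open>Reduced functions and regularized infima\<close>

lemma le_reduced: "\<phi> \<le> reduced W \<phi>"
  unfolding reduced_def by (rule Inf_greatest) auto

lemma reduced_le: "u \<in> W \<Longrightarrow> \<phi> \<le> u \<Longrightarrow> reduced W \<phi> \<le> u"
  unfolding reduced_def by (rule Inf_lower) auto

context balayage_space
begin

text \<open>The fine regularization lies in \<open>W\<close> by (B2) and so is lower semicontinuous
  in the initial topology. Being a minorant of \<open>Inf V\<close>, it cannot exceed the initial
  regularization, and the two coincide.\<close>

lemma lsc_reg_Inf_mem:
  assumes "V \<subseteq> W"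
  shows "lsc_reg (Inf V) \<in> W"
proof -
  let ?f = "lsc_reg_in (fine_topology W) (Inf V)"
  have "?f \<in> W"
    using assms by (rule B2)
  moreover have "lsc_reg (Inf V) \<le> ?f"
  proof (rule le_funI)
    fix x
    have "\<forall>a<lsc_reg (Inf V) x. \<exists>S. open S \<and> x \<in> S \<and> (\<forall>y\<in>S. a < Inf V y)"
      using le_lsc_reg_iff[of "lsc_reg (Inf V) x" "Inf V" x] by blast
    then show "lsc_reg (Inf V) x \<le> ?f x"
      by (subst le_lsc_reg_in_iff) (auto dest!: openin_fine_topology_open[where W = W])
  qed
  moreover have "?f \<le> lsc_reg (Inf V)"
    using lsc[OF \<open>?f \<in> W\<close>] by (intro lower_semicont_le_lsc_reg le_funI lsc_reg_in_le) auto
  ultimately show ?thesis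
    by (metis antisym)
qed

lemma reg_reduced_mem: "reg_reduced W \<phi> \<in> W"
  unfolding reg_reduced_def reduced_def by (rule lsc_reg_Inf_mem) auto

section \<open>Polar sets as exceptional sets for inequalities\<close>

lemma polar_fine_interior_empty:
  assumes P: "polar W P" and U: "openin (fine_topology W) U" "U \<subseteq> P"
  shows "U = {}"
proof (rule ccontr)
  let ?T = "fine_topology W"
  assume "U \<noteq> {}"
  then obtain x where x: "x \<in> U" by blast
  obtain u where u: "u \<in> W" "\<forall>y\<in>P - {x}. u y = \<infinity>" "u x < \<infinity>"
    using P unfolding polar_def by blast
  \<comment> \<open>Within \<open>U\<close> the function \<open>u\<close> is finite only at
    \<open>x\<close>, so intersecting with the finely open set where \<open>u\<close> is finite
    isolates \<open>x\<close>.\<close>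
  have "y = x" if "y \<in> U" "u y < \<infinity>" for y
    using that u(2) U(2) by (cases "y = x") auto
  then have "U \<inter> u -` {..<\<infinity>} = {x}"
    using x u(3) by blast
  then have sing: "openin ?T {x}"
    using openin_Int[OF U(1) openin_fine_topology_vimage[OF u(1), of "{..<\<infinity>}"]] by simp
  define V where "V = {v \<in> W. v x = \<infinity>}"
  define f where "f = lsc_reg_in ?T (Inf V)"
  have "f \<in> W"
    unfolding f_def by (rule B2) (auto simp: V_def)
  have "Inf V x = \<infinity>"
    by (auto simp: V_def Inf_fun_def)
  then have "\<infinity> \<le> f x"
    unfolding f_def using sing
    by (subst le_lsc_reg_in_iff) (auto simp del: Inf_apply intro!: exI[of _ "{x}"])
  \<comment> \<open>Polarity, now applied at \<open>y\<close>, gives a function infinite at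
    \<open>x\<close> and finite at \<open>y\<close>; all its positive multiples belong to
    \<open>V\<close>, and their values at \<open>y\<close> become arbitrarily small.\<close>
  moreover have "f y = 0" if "y \<noteq> x" for y
  proof -
    obtain v where v: "v \<in> W" "\<forall>z\<in>P - {y}. v z = \<infinity>" "v y < \<infinity>"
      using P unfolding polar_def by blast
    have vx: "v x = \<infinity>"
      using v(2) x U(2) that by auto
    have "Inf V y \<le> 0"
    proof (rule ennreal_le_epsilon)
      fix e :: real assume "0 < e"
      obtain c where c: "0 < c" "ennreal c * v y \<le> ennreal e"
        by (rule ennreal_scale_le[OF v(3) \<open>0 < e\<close>])
      have "(\<lambda>z. ennreal c * v z) \<in> V"
        using cone_scale[OF v(1), of c] c vx by (simp add: V_def ennreal_mult_top)
      then have "Inf V y \<le> ennreal c * v y"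
        by (auto simp: Inf_fun_def intro: INF_lower2)
      also note c(2)
      finally show "Inf V y \<le> 0 + ennreal e" by simp
    qed
    moreover have "f y \<le> Inf V y"
      unfolding f_def by (rule lsc_reg_in_le) simp
    ultimately show ?thesis by simp
  qed
  ultimately have "0 < f y \<longleftrightarrow> y = x" for y
    by (cases "y = x") (simp_all add: top_unique)
  then have "{y. 0 < f y} = {x}"
    by simp
  then have "open {x}"
    using lsc[OF \<open>f \<in> W\<close>] by (auto simp: lower_semicont_def dest: spec[of _ 0])
  then have "x \<in> interior P"
    using x U(2) by (intro interiorI[of "{x}"]) auto
  then show False
    using P by (simp add: polar_def)
qed

lemma le_if_le_off_polar:
  assumes "polar W P" "u \<in> W" "v \<in> W" and le: "\<And>x. x \<notin> P \<Longrightarrow> u x \<le> v x"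
  shows "u \<le> v"
proof (rule le_funI, rule ccontr)
  fix x assume "\<not> u x \<le> v x"
  then obtain r where r: "v x < r" "r < u x"
    using dense by (metis linorder_not_less)
  \<comment> \<open>A fixed level \<open>r\<close> turns the comparison of two functions into
    preimages of open rays; a point with \<open>v < r < u\<close> must lie in
    \<open>P\<close>.\<close>
  define U where "U = v -` {..<r} \<inter> u -` {r<..}"
  have "openin (fine_topology W) U"
    unfolding U_def using assms by (intro openin_Int openin_fine_topology_vimage) auto
  moreover have "U \<subseteq> P"
    using le by (force simp: U_def)
  ultimately have "U = {}"
    using polar_fine_interior_empty assms(1) by blast
  then show False
    using r by (auto simp: U_def)
qed

text \<open>Small multiples of a function that is infinite on \<open>P - {x}\<close> repair the
  majorization there and cost arbitrarily little at \<open>x\<close>. As that function is finite at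
  \<open>x\<close>, the inequality at \<open>x\<close> itself has to be assumed even when
  \<open>x\<close> lies in \<open>P\<close>.\<close>

lemma reduced_le_of_le_off_polar:
  assumes P: "polar W P" and v: "v \<in> W" and le: "\<And>y. y \<notin> P - {x} \<Longrightarrow> \<phi> y \<le> v y"
  shows "reduced W \<phi> x \<le> v x"
proof -
  obtain u where u: "u \<in> W" "\<forall>y\<in>P - {x}. u y = \<infinity>" "u x < \<infinity>"
    using P unfolding polar_def by blast
  show ?thesis
  proof (rule ennreal_le_epsilon)
    fix e :: real assume e: "0 < e"
    obtain c where c: "0 < c" "ennreal c * u x \<le> ennreal e"
      by (rule ennreal_scale_le[OF u(3) e])
    have "(\<lambda>z. v z + ennreal c * u z) \<in> W"
      using c by (intro cone_add cone_scale v u) auto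
    moreover have "\<phi> \<le> (\<lambda>z. v z + ennreal c * u z)"
    proof (rule le_funI)
      fix y show "\<phi> y \<le> v y + ennreal c * u y"
        using u(2) le[of y] c by (cases "y \<in> P - {x}") (auto simp: ennreal_mult_top intro: add_increasing2)
    qed
    ultimately have "reduced W \<phi> \<le> (\<lambda>z. v z + ennreal c * u z)"
      by (rule reduced_le)
    then have "reduced W \<phi> x \<le> v x + ennreal c * u x"
      by (rule le_funD)
    also have "\<dots> \<le> v x + ennreal e"
      using c(2) by (rule add_left_mono)
    finally show "reduced W \<phi> x \<le> v x + ennreal e" .
  qed
qed

text \<open>The regularized function is itself a competitor for the truncated \<phi>. Conversely,
  every competitor dominates it off \<open>P\<close> by the preceding lemma, hence everywhere,
  because both are in \<open>W\<close> and inequalities in \<open>W\<close> extend across polar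
  sets.\<close>

lemma reduced_off_polar_eq:
  assumes P: "polar W P" and eq: "\<And>x. x \<notin> P \<Longrightarrow> reg_reduced W \<phi> x = reduced W \<phi> x"
  shows "reduced W (\<lambda>y. \<phi> y * indicator (- P) y) = reg_reduced W \<phi>"
proof (rule antisym)
  show "reduced W (\<lambda>y. \<phi> y * indicator (- P) y) \<le> reg_reduced W \<phi>"
  proof (intro reduced_le reg_reduced_mem le_funI)
    fix y show "\<phi> y * indicator (- P) y \<le> reg_reduced W \<phi> y"
      using eq[of y] le_funD[OF le_reduced, of \<phi> y] by (cases "y \<in> P") auto
  qed
  show "reg_reduced W \<phi> \<le> reduced W (\<lambda>y. \<phi> y * indicator (- P) y)"
    unfolding reduced_def[of W "\<lambda>y. \<phi> y * indicator (- P) y"]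
  proof (rule Inf_greatest, clarify)
    fix v assume v: "v \<in> W" "(\<lambda>y. \<phi> y * indicator (- P) y) \<le> v"
    have off: "\<phi> y \<le> v y" if "y \<notin> P" for y
      using le_funD[OF v(2), of y] that by simp
    show "reg_reduced W \<phi> \<le> v"
      using P reg_reduced_mem v(1)
    proof (rule le_if_le_off_polar)
      fix x assume "x \<notin> P"
      then show "reg_reduced W \<phi> x \<le> v x"
        using reduced_le_of_le_off_polar[OF P v(1), of x \<phi>] off by (simp add: eq)
    qed
  qed
qed

lemma reduced_eq_max_reg_reduced:
  assumes P: "polar W P" and eq: "\<And>x. x \<notin> P \<Longrightarrow> reg_reduced W \<phi> x = reduced W \<phi> x"
  shows "reduced W \<phi> x = max (\<phi> x) (reg_reduced W \<phi> x)"
proof (rule antisym)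
  let ?w = "reg_reduced W \<phi>"
  have off: "\<phi> y \<le> ?w y" if "y \<notin> P" for y
    using eq[OF that] le_funD[OF le_reduced, of \<phi> y] by simp
  show "max (\<phi> x) (?w x) \<le> reduced W \<phi> x"
    using le_funD[OF le_reduced, of \<phi> x] le_funD[OF lsc_reg_le, of "reduced W \<phi>" x]
    by (simp add: reg_reduced_def)
  show "reduced W \<phi> x \<le> max (\<phi> x) (?w x)"
  proof (cases "\<phi> x \<le> ?w x")
    case True
    then have "reduced W \<phi> x \<le> ?w x"
      using off by (intro reduced_le_of_le_off_polar[OF P reg_reduced_mem]) auto
    then show ?thesis
      by (simp add: le_max_iff_disj)
  next
    case False
    show ?thesis
    proof (cases "\<phi> x = \<infinity>")
      case finite: False
      obtain f where f: "f \<in> W" "0 < f x" "f x < \<infinity>"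
        using B4_infinity by (auto simp: cont_real_def)
      \<comment> \<open>This constant makes \<open>?w + c * f\<close> equal to \<phi> at
        \<open>x\<close>; the quotient is meaningful because \<phi> is finite at \<open>x\<close>
        and \<open>f\<close> is positive and finite there.\<close>
      define c where "c = enn2real (\<phi> x - ?w x) / enn2real (f x)"
      have c: "0 \<le> c"
        by (simp add: c_def)
      have "ennreal c * f x = ennreal (c * enn2real (f x))"
        using c f(3) by (simp add: ennreal_mult ennreal_enn2real)
      also have "c * enn2real (f x) = enn2real (\<phi> x - ?w x)"
        using f(2,3) by (auto simp: c_def enn2real_eq_0_iff)
      also have "ennreal \<dots> = \<phi> x - ?w x"
        using finite le_less_trans[OF diff_le_self_ennreal] by (simp add: ennreal_enn2real less_top)
      finally have val: "?w x + ennreal c * f x = \<phi> x"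
        using False by (simp add: add_diff_inverse_ennreal)
      have "reduced W \<phi> x \<le> ?w x + ennreal c * f x"
      proof (rule reduced_le_of_le_off_polar[OF P])
        show "(\<lambda>y. ?w y + ennreal c * f y) \<in> W"
          using c f(1) by (intro cone_add cone_scale reg_reduced_mem) auto
        fix y assume "y \<notin> P - {x}"
        then show "\<phi> y \<le> ?w y + ennreal c * f y"
          using off[of y] val by (cases "y = x") (auto intro: add_increasing2)
      qed
      then show ?thesis
        by (simp add: val le_max_iff_disj)
    qed simp
  qed
qed

text \<open>The reduced function lies between its regularization and a countable infimum
  \<open>Inf D\<close>, both Borel. By the choice of \<open>D\<close> they differ only on a
  semipolar set, which the axiom makes polar.\<close>

lemma reduced_nearly_Borel:
  assumes "axiom_of_polarity W"
  shows "(\<lambda>x. enn2ereal (reduced W \<phi> x)) \<in> nearly_Borel_functions W"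
proof -
  let ?V = "{u \<in> W. \<phi> \<le> u}"
  obtain D where D: "countable D" "D \<subseteq> ?V" "lsc_reg (Inf D) = lsc_reg (Inf ?V)"
    by (rule choquet_lsc_reg)
  have reg: "reg_reduced W \<phi> = lsc_reg (Inf D)"
    by (simp add: D(3) reg_reduced_def reduced_def)
  let ?g = "\<lambda>x. enn2ereal (reg_reduced W \<phi> x)" and ?h = "\<lambda>x. enn2ereal (Inf D x)"
  have "(\<lambda>x. INF u\<in>D. u x) \<in> borel_measurable borel"
    using D(1,2) lsc by (intro borel_measurable_INF) (auto intro: lower_semicont_borel_measurable)
  then have h: "?h \<in> Borel_functions"
    by (simp add: Borel_functions_def)
  have "reg_reduced W \<phi> \<in> borel_measurable borel"
    using lsc reg_reduced_mem lower_semicont_borel_measurable by blast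
  then have g: "?g \<in> Borel_functions"
    by (simp add: Borel_functions_def)
  have "reg_reduced W \<phi> \<le> reduced W \<phi>"
    unfolding reg_reduced_def by (rule lsc_reg_le)
  then have gle: "?g \<le> (\<lambda>x. enn2ereal (reduced W \<phi> x))"
    by (simp add: le_fun_def flip: less_eq_ennreal.rep_eq)
  have "reduced W \<phi> \<le> Inf D"
    unfolding reduced_def by (rule Inf_superset_mono[OF D(2)])
  then have hle: "(\<lambda>x. enn2ereal (reduced W \<phi> x)) \<le> ?h"
    by (simp add: le_fun_def flip: less_eq_ennreal.rep_eq)
  have "polar W {x. lsc_reg (Inf D) x < Inf D x}"
    using assms D(2) unfolding axiom_of_polarity_def semipolar_def by blast
  moreover have "?g x = ?h x" if "x \<notin> {x. lsc_reg (Inf D) x < Inf D x}" for x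
    using that le_funD[OF lsc_reg_le, of "Inf D" x] by (simp add: reg antisym del: Inf_apply)
  ultimately have "\<exists>P. polar W P \<and> (\<forall>x. x \<notin> P \<longrightarrow> ?g x = ?h x)"
    by blast
  with g h gle hle show ?thesis
    unfolding nearly_Borel_functions_def by fast
qed

end

theorem proposition2p1:
  fixes W :: "('a::{t2_space, second_countable_topology} \<Rightarrow> ennreal) set"
    and \<phi> :: "'a \<Rightarrow> ennreal" and P :: "'a set"
  assumes "balayage_space W"
    and "axiom_of_polarity W"
    and "polar W P"
    and "\<forall>x. x \<notin> P \<longrightarrow> reg_reduced W \<phi> x = reduced W \<phi> x"
  shows "reduced W \<phi> =
           (\<lambda>x. max (\<phi> x * indicator P x) (reg_reduced W (\<lambda>y. \<phi> y * indicator (- P) y) x))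
       \<and> reduced W \<phi> = (\<lambda>x. max (\<phi> x) (reg_reduced W \<phi> x))
       \<and> reg_reduced W (\<lambda>y. \<phi> y * indicator (- P) y) = reduced W (\<lambda>y. \<phi> y * indicator (- P) y)
       \<and> reduced W (\<lambda>y. \<phi> y * indicator (- P) y) = reg_reduced W \<phi>
       \<and> (\<lambda>x. enn2ereal (reduced W \<phi> x)) \<in> nearly_Borel_functions W
       \<and> ((\<lambda>x. enn2ereal (\<phi> x)) \<in> Borel_functions \<longrightarrow>
            (\<lambda>x. enn2ereal (reduced W \<phi> x)) \<in> Borel_functions)"
proof -
  interpret balayage_space W by fact
  let ?\<psi> = "\<lambda>y. \<phi> y * indicator (- P) y" and ?w = "reg_reduced W \<phi>"
  have red: "reduced W ?\<psi> = ?w"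
    using assms(3,4) by (intro reduced_off_polar_eq) auto
  \<comment> \<open>The reduced function of the truncation is \<open>?w\<close>, which is already
    lower semicontinuous as a member of \<open>W\<close>.\<close>
  have reg: "reg_reduced W ?\<psi> = ?w"
    using lsc_reg_eq[OF lsc[OF reg_reduced_mem[of \<phi>]]] by (simp add: reg_reduced_def[of W ?\<psi>] red)
  have max: "reduced W \<phi> x = max (\<phi> x) (?w x)" for x
    using assms(3,4) by (intro reduced_eq_max_reg_reduced) auto
  \<comment> \<open>Off \<open>P\<close> the first entry vanishes, and the hypothesis says that the
    reduced function equals \<open>?w\<close> there.\<close>
  have max': "reduced W \<phi> x = max (\<phi> x * indicator P x) (?w x)" for x
    using assms(4) by (cases "x \<in> P") (auto simp: max)
  have Borel: "(\<lambda>x. enn2ereal (reduced W \<phi> x)) \<in> Borel_functions"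
    if "(\<lambda>x. enn2ereal (\<phi> x)) \<in> Borel_functions"
  proof -
    have "?w \<in> borel_measurable borel"
      using lsc reg_reduced_mem lower_semicont_borel_measurable by blast
    moreover have "enn2ereal (reduced W \<phi> x) = max (enn2ereal (\<phi> x)) (enn2ereal (?w x))" for x
      by (simp add: max max_def less_eq_ennreal.rep_eq)
    ultimately show ?thesis
      using that by (simp add: Borel_functions_def)
  qed
  show ?thesis
    unfolding red reg
    by (intro conjI impI ext max max' refl reduced_nearly_Borel assms(2) Borel)
qed

end
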